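(* Let $0<q<1$, $\gamma>-1$ and $c>0$. Put $y_n(z;q)=\mathfrak{L}_n^{(\gamma)}(z,c;q)$ for $n\in\mathbb{N}_0$, and $y_{-1}(z;q)=y_{-2}(z;q)=0$. Then these polynomials satisfy the recurrence relation $$q\mu'_{q,1}(n)\,y_{n-2}(z;q)+\bigl(q\mu'_{q,2}(n)-z\,\mu'_{q,5}(n)\bigr)y_{n-1}(z;q)+\bigl(q\mu'_{q,3}(n)-z\,\mu'_{q,6}(n)\bigr)y_n(z;q)+q\mu'_{q,4}(n)\,y_{n+1}(z;q)=0,\qquad n\in\mathbb{N}_0,$$ where for $n\ge2$ $$\begin{aligned} \mu'_{q,3}(n)&=-q^{3n+2\gamma+1}\Bigl(\tfrac{(1-q^{n+1})(1-q^{\gamma+n+1})(1-q^{c+n+1})}{1-q}+q^2(1-q^{\gamma+n})(1-q^{c+n})-\tfrac{q^2(1-q^{n+1})(1-q^{\gamma+n})(1-q^{c+n})}{1-q}\Bigr),\\ \mu'_{q,4}(n)&=q^{3n+2\gamma+1}(1-q^{\gamma+n+1})(1-q^{c+n+1}),\\ \mu'_{q,5}(n)&=q^{5n+3\gamma+3}(1-q^n),\\ \mu'_{q,6}(n)&=-q^{5n+3\gamma+3}(1-q^{n+1}),\\ \mu'_{q,2}(n)&=\tfrac{q^{3n+2\gamma+1}(1-q^{\gamma+n+1})(1-q^{c+n+1})[q^{n+1};q]_2}{(1-q)^2}+\tfrac{q^{3n+2\gamma+3}(1-q^{\gamma+n})(1-q^{c+n})(1-q^n)}{1-q}\\ &\quad-\tfrac{q^{3n+2\gamma+3}(1-q^{\gamma+n})(1-q^{c+n})[q^{n+1};q]_2}{(1-q)^2}-\tfrac{q^{3n+2\gamma+1}(1-q^{\gamma+n+1})(1-q^{c+n+1})[q^{n+1};q]_2}{[q^2;q]_2}\\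 &\quad-\tfrac{q^{3n+2\gamma+5}(1-q^{\gamma+n-1})(1-q^{c+n-1})(1-q^n)}{1-q}+\tfrac{q^{3n+2\gamma+5}(1-q^{\gamma+n-1})(1-q^{c+n-1})[q^{n+1};q]_2}{[q^2;q]_2},\\ \mu'_{q,1}(n)&=-\mu'_{q,2}(n)-\mu'_{q,3}(n)-\mu'_{q,4}(n). \end{aligned}$$ For $n=0,1$, the coefficients $\mu'_{q,3}(n),\mu'_{q,4}(n),\mu'_{q,6}(n)$ are given by the same expressions, and moreover $$\mu'_{q,5}(0)=\mu'_{q,2}(0)=\mu'_{q,1}(0)=\mu'_{q,1}(1)=0,\qquad \mu'_{q,5}(1)=q^{3\gamma+8}(1-q),$$ $$\mu'_{q,2}(1)=q^{2\gamma+5}(1-q^{\gamma+2})(1-q^{c+2})-q^{2\gamma+7}(1-q^{\gamma+1})(1-q^{c+1}).$$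
   Context: $(b;q)_0=1$ and $(b;q)_k=(1-b)(1-bq)\cdots(1-bq^{k-1})$ for $k\ge1$. The bracket symbol is $[b;q]_2=(1-b)(1-bq^{-1})$. The generalized $q$-Laguerre polynomial is $$\mathfrak{L}_n^{(\gamma)}(z,c;q)={}_2\phi_2\left[{q^{-n},\,q \atop q^{\gamma+1},\,q^{c+1}};q;-q^{n+\gamma+1}z\right]=\sum_{i=0}^{n}\frac{(q^{-n};q)_i}{(q^{\gamma+1};q)_i\,(q^{c+1};q)_i}(-1)^iq^{i(i-1)/2}\bigl(-q^{n+\gamma+1}z\bigr)^i .$$ *)

theory Defs
  imports "HOL-Analysis.Analysis"
begin

definition qpoch :: "'a::comm_ring_1 \<Rightarrow> 'a \<Rightarrow> nat \<Rightarrow> 'a" where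
  "qpoch b q k = (\<Prod>j<k. 1 - b * q ^ j)"

definition qbracket2 :: "real \<Rightarrow> real \<Rightarrow> real" where
  "qbracket2 b q = (1 - b) * (1 - b / q)"

text \<open>The basic hypergeometric series with two numerator parameters \<open>a1\<close>, \<open>a2\<close> and two
  denominator parameters \<open>b1\<close>, \<open>b2\<close>; as usual, the terms carry a further factor
  \<open>(q;q)\<^sub>k\<close> in the denominator.\<close>

definition phi22 :: "complex \<Rightarrow> complex \<Rightarrow> complex \<Rightarrow> complex \<Rightarrow> complex \<Rightarrow> complex \<Rightarrow> complex" where
  "phi22 a1 a2 b1 b2 q x =
     (\<Sum>k. qpoch a1 q k * qpoch a2 q k / (qpoch b1 q k * qpoch b2 q k * qpoch q q k)
          * ((-1) ^ k * q ^ (k choose 2)) * x ^ k)"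

definition qLaguerre :: "real \<Rightarrow> real \<Rightarrow> real \<Rightarrow> nat \<Rightarrow> complex \<Rightarrow> complex" where
  "qLaguerre \<gamma> c q n z =
     phi22 (of_real (q powr (- real n))) (of_real q)
           (of_real (q powr (\<gamma> + 1))) (of_real (q powr (c + 1)))
           (of_real q) (- of_real (q powr (real n + \<gamma> + 1)) * z)"

text \<open>The series terminates, and \<open>(q;q)\<^sub>k\<close> cancels against the second numerator parameter.\<close>

lemma qLaguerre_finite_sum:
  assumes "0 < q" "q < 1"
  shows "qLaguerre \<gamma> c q n z =
    (\<Sum>i=0..n. of_real (qpoch (q powr (- real n)) q i
                  / (qpoch (q powr (\<gamma> + 1)) q i * qpoch (q powr (c + 1)) q i))
             * (-1) ^ i * of_real (q ^ (i * (i - 1) div 2))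
             * (- of_real (q powr (real n + \<gamma> + 1)) * z) ^ i)"
proof -
  have of_real_qpoch: "qpoch (of_real b) (of_real q) k = (of_real (qpoch b q k) :: complex)" for b k
    by (simp add: qpoch_def)
  have nz: "qpoch q q k \<noteq> 0" for k
  proof -
    have "q * q ^ j \<noteq> 1" for j
      using assms power_Suc_less_one[of q j] by simp
    then show ?thesis by (auto simp: qpoch_def)
  qed
  have zero: "qpoch (q powr (- real n)) q k = 0" if "k \<notin> {0..n}" for k
  proof -
    have "q powr (- real n) * q ^ n = 1"
      using assms by (simp add: powr_minus powr_realpow)
    then show ?thesis using that by (auto simp: qpoch_def prod_zero_iff intro!: bexI[of _ n])
  qed
  show ?thesis
    unfolding qLaguerre_def phi22_def of_real_qpoch
    by (subst suminf_finite[where N = "{0..n}"])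
      (auto simp: zero nz choose_two mult.assoc intro!: sum.cong)
qed

text \<open>The index is an integer so that the sequence can be continued by zero to the left.\<close>

definition qLaguerre_seq :: "real \<Rightarrow> real \<Rightarrow> real \<Rightarrow> int \<Rightarrow> complex \<Rightarrow> complex" where
  "qLaguerre_seq \<gamma> c q k z = (if k < 0 then 0 else qLaguerre \<gamma> c q (nat k) z)"

definition mu3 :: "real \<Rightarrow> real \<Rightarrow> real \<Rightarrow> nat \<Rightarrow> real" where
  "mu3 \<gamma> c q n =
     - (q powr (3 * n + 2 * \<gamma> + 1)) *
       ((1 - q ^ (n + 1)) * (1 - q powr (\<gamma> + n + 1)) * (1 - q powr (c + n + 1)) / (1 - q)
        + q\<^sup>2 * (1 - q powr (\<gamma> + n)) * (1 - q powr (c + n))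
        - q\<^sup>2 * (1 - q ^ (n + 1)) * (1 - q powr (\<gamma> + n)) * (1 - q powr (c + n)) / (1 - q))"

definition mu4 :: "real \<Rightarrow> real \<Rightarrow> real \<Rightarrow> nat \<Rightarrow> real" where
  "mu4 \<gamma> c q n =
     q powr (3 * n + 2 * \<gamma> + 1) * (1 - q powr (\<gamma> + n + 1)) * (1 - q powr (c + n + 1))"

definition mu5 :: "real \<Rightarrow> real \<Rightarrow> nat \<Rightarrow> real" where
  "mu5 \<gamma> q n =
     (if n = 0 then 0
      else if n = 1 then q powr (3 * \<gamma> + 8) * (1 - q)
      else q powr (5 * n + 3 * \<gamma> + 3) * (1 - q ^ n))"

definition mu6 :: "real \<Rightarrow> real \<Rightarrow> nat \<Rightarrow> real" where
  "mu6 \<gamma> q n = - (q powr (5 * n + 3 * \<gamma> + 3)) * (1 - q ^ (n + 1))"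

definition mu2 :: "real \<Rightarrow> real \<Rightarrow> real \<Rightarrow> nat \<Rightarrow> real" where
  "mu2 \<gamma> c q n =
     (if n = 0 then 0
      else if n = 1 then
        q powr (2 * \<gamma> + 5) * (1 - q powr (\<gamma> + 2)) * (1 - q powr (c + 2))
        - q powr (2 * \<gamma> + 7) * (1 - q powr (\<gamma> + 1)) * (1 - q powr (c + 1))
      else
        q powr (3 * n + 2 * \<gamma> + 1) * (1 - q powr (\<gamma> + n + 1)) * (1 - q powr (c + n + 1))
          * qbracket2 (q ^ (n + 1)) q / (1 - q)\<^sup>2
        + q powr (3 * n + 2 * \<gamma> + 3) * (1 - q powr (\<gamma> + n)) * (1 - q powr (c + n))
          * (1 - q ^ n) / (1 - q)
        - q powr (3 * n + 2 * \<gamma> + 3) * (1 - q powr (\<gamma> + n)) * (1 - q powr (c + n))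
          * qbracket2 (q ^ (n + 1)) q / (1 - q)\<^sup>2
        - q powr (3 * n + 2 * \<gamma> + 1) * (1 - q powr (\<gamma> + n + 1)) * (1 - q powr (c + n + 1))
          * qbracket2 (q ^ (n + 1)) q / qbracket2 (q\<^sup>2) q
        - q powr (3 * n + 2 * \<gamma> + 5) * (1 - q powr (\<gamma> + n - 1)) * (1 - q powr (c + n - 1))
          * (1 - q ^ n) / (1 - q)
        + q powr (3 * n + 2 * \<gamma> + 5) * (1 - q powr (\<gamma> + n - 1)) * (1 - q powr (c + n - 1))
          * qbracket2 (q ^ (n + 1)) q / qbracket2 (q\<^sup>2) q)"

definition mu1 :: "real \<Rightarrow> real \<Rightarrow> real \<Rightarrow> nat \<Rightarrow> real" where
  "mu1 \<gamma> c q n =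
     (if n \<le> 1 then 0 else - mu2 \<gamma> c q n - mu3 \<gamma> c q n - mu4 \<gamma> c q n)"

end

theory Submission
  imports Defs
begin

text \<open>
  Write \<open>X = q\<^sup>n\<close>, \<open>G = q\<^sup>\<gamma>\<close>, \<open>C = q\<^sup>c\<close>. Absorbing the powers of \<open>q\<^sup>n\<close> into
  \<open>(q\<^sup>-\<^sup>n; q)\<^sub>i\<close> turns the polynomial into
  \<open>y\<^sub>n(z) = \<Sum>\<^sub>i u\<^sub>i N(X, i) z\<^sup>i\<close> with \<open>N(X, i) = \<Prod>\<^sub>j\<^sub><\<^sub>i (X - q\<^sup>j)\<close>,
  where \<open>u\<^sub>i\<close> is independent of \<open>n\<close>, and \<open>u\<^sub>i\<^sub>+\<^sub>1 A(q\<^sup>i\<^sup>+\<^sup>1) = G q\<^sup>i\<^sup>+\<^sup>1 u\<^sub>i\<close> for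
  \<open>A(Y) = (1 - G Y)(1 - C Y)\<close>. Changing \<open>n\<close> now only rescales the first argument of \<open>N\<close> by a
  power of \<open>q\<close>.

  Comparing coefficients of \<open>z\<^sup>i\<close>, the terms with \<open>\<mu>\<^sub>5\<close> and \<open>\<mu>\<^sub>6\<close> collapse to a multiple of
  \<open>(q\<^sup>i - 1) N(X, i - 1)\<close>, and what remains is an expansion of this single product in
  \<open>N(X/q\<^sup>2, i)\<close>, \<open>N(X/q, i)\<close>, \<open>N(X, i)\<close>, \<open>N(q X, i)\<close>, with coefficients proportional to
  \<open>\<mu>\<^sub>1, \<dots>, \<mu>\<^sub>4\<close>. Up to a common factor these four products are, as functions of \<open>Y = q\<^sup>i\<close>, scalar
  multiples of \<open>(Y - q X)(Y - X)(Y - X/q)\<close>, \<open>Y (Y - q X)(Y - X)\<close>, \<open>Y\<^sup>2 (Y - q X)\<close>, \<open>Y\<^sup>3\<close>,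
  while the right-hand side becomes a multiple of the cubic \<open>(Y - 1) A(Y)\<close>. Evaluating at
  \<open>Y = q X\<close>, \<open>X\<close>, \<open>X/q\<close>, \<open>1\<close> gives a triangular system: the first three points determine
  \<open>\<mu>\<^sub>4, \<mu>\<^sub>3, \<mu>\<^sub>2\<close> from the values \<open>A(q X)\<close>, \<open>A(X)\<close>, \<open>A(X/q)\<close> that are visible in their formulas,
  and \<open>Y = 1\<close>, where the right-hand side vanishes, says that \<open>\<mu>\<^sub>1 + \<dots> + \<mu>\<^sub>4 = 0\<close>. The identity
  itself is \<open>newton_prod_combination\<close>; with \<open>newton_prod_lowering\<close>, which collapses the
  multiples of \<open>z\<close>, it yields \<open>laguerre_sum_recurrence\<close> for an arbitrary real \<open>X\<close>.

  The cases \<open>n = 0, 1\<close> need no different argument. At \<open>X = 1\<close> and \<open>X = q\<close> the general formulas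
  reproduce the special values of the coefficients (\<open>mu_eq_nu\<close>); in particular the coefficients of
  \<open>y\<^sub>-\<^sub>1\<close> and \<open>y\<^sub>-\<^sub>2\<close> vanish, so these may be set to zero although the corresponding
  sums do not vanish.
\<close>

section \<open>Products shifted by powers of q\<close>

definition newton_prod :: "real \<Rightarrow> real \<Rightarrow> nat \<Rightarrow> real" where
  "newton_prod q x i = (\<Prod>j<i. x - q ^ j)"

lemma newton_prod_Suc: "newton_prod q x (Suc i) = (x - q ^ i) * newton_prod q x i"
  by (simp add: newton_prod_def mult.commute)

text \<open>
  Rescaling by \<open>q\<close> moves the zeros \<open>1, q, \<dots>, q\<^sup>i\<close> one step down, so that all factors but the first
  reappear.
\<close>

lemma newton_prod_shift: "newton_prod q (q * x) (Suc i) = q ^ i * (q * x - 1) * newton_prod q x i"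
proof (induction i)
  case 0
  show ?case by (simp add: newton_prod_def)
next
  case (Suc i)
  have "newton_prod q (q * x) (Suc (Suc i)) = (q * x - q ^ Suc i) * newton_prod q (q * x) (Suc i)"
    by (rule newton_prod_Suc)
  also have "q * x - q ^ Suc i = q * (x - q ^ i)"
    by (simp add: right_diff_distrib)
  also have "q * (x - q ^ i) * newton_prod q (q * x) (Suc i) = q ^ Suc i * (q * x - 1) * newton_prod q x (Suc i)"
    unfolding Suc newton_prod_Suc[of q x] by simp
  finally show ?case .
qed

lemma newton_prod_eq_0: "k < i \<Longrightarrow> newton_prod q (q ^ k) i = 0"
  by (auto simp: newton_prod_def)

text \<open>
  Both sides are \<open>newton_prod q (q\<^sup>2 * x) (Suc i)\<close>, once split at the first factor and once at the
  last. With \<open>X = q\<^sup>2 x\<close> it lets the factor \<open>1 - X\<close> in \<open>\<mu>\<^sub>5\<close> undo the shift from \<open>n\<close> to \<open>n - 1\<close>.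
\<close>

lemma newton_prod_lowering:
  "q ^ i * ((q\<^sup>2 * x - 1) * newton_prod q (q * x) i) = (q\<^sup>2 * x - q ^ i) * newton_prod q (q\<^sup>2 * x) i"
proof -
  have "newton_prod q (q * (q * x)) (Suc i) = q ^ i * (q * (q * x) - 1) * newton_prod q (q * x) i"
    by (rule newton_prod_shift)
  then show ?thesis by (simp add: newton_prod_Suc power2_eq_square mult.assoc)
qed

section \<open>The coefficients as functions of X\<close>

text \<open>
  The factor by which the denominator \<open>(q\<^sup>\<gamma>\<^sup>+\<^sup>1; q)\<^sub>i (q\<^sup>c\<^sup>+\<^sup>1; q)\<^sub>i\<close> grows in step \<open>i\<close>, as a
  function of \<open>Y = q\<^sup>i\<close>.
\<close>

definition denom_factor :: "real \<Rightarrow> real \<Rightarrow> real \<Rightarrow> real" where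
  "denom_factor G C Y = (1 - G * Y) * (1 - C * Y)"

text \<open>
  The coefficients \<open>\<mu>\<^sub>1, \<dots>, \<mu>\<^sub>4\<close> with the common factor \<open>q\<^sup>3\<^sup>n\<^sup>+\<^sup>2\<^sup>\<gamma>\<^sup>+\<^sup>1\<close> removed and with \<open>q\<^sup>n\<close>
  replaced by a free variable \<open>X\<close>.
\<close>

definition nu4 :: "real \<Rightarrow> real \<Rightarrow> real \<Rightarrow> real \<Rightarrow> real" where
  "nu4 q G C X = denom_factor G C (q * X)"

definition nu3 :: "real \<Rightarrow> real \<Rightarrow> real \<Rightarrow> real \<Rightarrow> real" where
  "nu3 q G C X =
    - ((1 - q * X) * denom_factor G C (q * X) / (1 - q) + q\<^sup>2 * denom_factor G C X
       - q\<^sup>2 * (1 - q * X) * denom_factor G C X / (1 - q))"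

definition nu2 :: "real \<Rightarrow> real \<Rightarrow> real \<Rightarrow> real \<Rightarrow> real" where
  "nu2 q G C X =
      denom_factor G C (q * X) * ((1 - q * X) * (1 - X)) / (1 - q)\<^sup>2
    + q\<^sup>2 * denom_factor G C X * (1 - X) / (1 - q)
    - q\<^sup>2 * denom_factor G C X * ((1 - q * X) * (1 - X)) / (1 - q)\<^sup>2
    - denom_factor G C (q * X) * ((1 - q * X) * (1 - X)) / ((1 - q\<^sup>2) * (1 - q))
    - q ^ 4 * denom_factor G C (X / q) * (1 - X) / (1 - q)
    + q ^ 4 * denom_factor G C (X / q) * ((1 - q * X) * (1 - X)) / ((1 - q\<^sup>2) * (1 - q))"

definition nu1 :: "real \<Rightarrow> real \<Rightarrow> real \<Rightarrow> real \<Rightarrow> real" where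
  "nu1 q G C X = - nu2 q G C X - nu3 q G C X - nu4 q G C X"

text \<open>
  Over the common denominator \<open>(1 - q)\<^sup>2 (1 + q)\<close> the coefficients become polynomials in \<open>q\<close>, \<open>X\<close> and
  the three values of \<open>denom_factor\<close>, which makes them accessible to polynomial arithmetic.
\<close>

lemma nu_cleared:
  fixes q G C X :: real
  assumes q: "1 - q \<noteq> 0" "1 + q \<noteq> 0"
  defines "D \<equiv> (1 - q)\<^sup>2 * (1 + q)"
  defines "a \<equiv> denom_factor G C (q * X)" and "b \<equiv> denom_factor G C X" and "d \<equiv> denom_factor G C (X / q)"
  shows "D * nu3 q G C X =
           - (1 - q) * (1 + q) * ((1 - q * X) * (a - q\<^sup>2 * b) + (1 - q) * q\<^sup>2 * b)"
    and "D * nu2 q G C X =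
           (1 - X) * ((1 - q * X) * (q * a - q\<^sup>2 * (1 + q) * b + q ^ 4 * d)
             + (1 - q) * (1 + q) * (q\<^sup>2 * b - q ^ 4 * d))"
proof -
  have s: "(1 - q\<^sup>2) * (1 - q) = D"
    by (simp add: D_def power2_eq_square algebra_simps)
  have f: "D * (y / D) = y" "D * (y / (1 - q)\<^sup>2) = (1 + q) * y"
      "D * (y / (1 - q)) = (1 - q) * (1 + q) * y" for y
    using q by (simp_all add: power2_eq_square D_def)
  show "D * nu3 q G C X =
          - (1 - q) * (1 + q) * ((1 - q * X) * (a - q\<^sup>2 * b) + (1 - q) * q\<^sup>2 * b)"
    unfolding nu3_def a_def[symmetric] b_def[symmetric] right_diff_distrib distrib_left
      mult_minus_right f
    unfolding D_def by algebra
  show "D * nu2 q G C X =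
          (1 - X) * ((1 - q * X) * (q * a - q\<^sup>2 * (1 + q) * b + q ^ 4 * d)
            + (1 - q) * (1 + q) * (q\<^sup>2 * b - q ^ 4 * d))"
    unfolding nu2_def s a_def[symmetric] b_def[symmetric] d_def[symmetric]
      right_diff_distrib[of D] distrib_left[of D] f
    by algebra
qed

section \<open>The connecting identity\<close>

text \<open>
  The polynomial content of \<open>newton_prod_combination\<close> below, free of denominators thanks to the
  parametrisation \<open>X = q\<^sup>2 x\<close>. The first identity is the generic case \<open>i \<ge> 3\<close>, with \<open>y = q\<^sup>i\<^sup>-\<^sup>3\<close> and
  the common factors of the products divided out: an equality of cubics in \<open>y\<close>, as one sees
  by evaluating at \<open>q\<^sup>3 y = q X, X, X/q, 1\<close>. For \<open>i = 1, 2\<close> the products are too short to contain these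
  common factors, hence the two separate identities.
\<close>

lemma newton_prod_combination_cleared:
  fixes q G C x y D n1 n2 n3 n4 :: real
  assumes "a = denom_factor G C (q ^ 3 * x)" "b = denom_factor G C (q\<^sup>2 * x)" "d = denom_factor G C (q * x)"
    and "n4 = D * a" "D = (1 - q)\<^sup>2 * (1 + q)"
    and "n3 = - (1 - q) * (1 + q) * ((1 - q ^ 3 * x) * (a - q\<^sup>2 * b) + (1 - q) * q\<^sup>2 * b)"
    and "n2 = (1 - q\<^sup>2 * x) * ((1 - q ^ 3 * x) * (q * a - q\<^sup>2 * (1 + q) * b + q ^ 4 * d)
         + (1 - q) * (1 + q) * (q\<^sup>2 * b - q ^ 4 * d))"
    and "n1 = - n2 - n3 - n4"
  shows
    "n1 * ((x - y) * (x - q * y) * (x - q\<^sup>2 * y))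
       + n2 * (q\<^sup>2 * y * (q * x - 1) * ((x - y) * (x - q * y)))
       + n3 * (q ^ 3 * y\<^sup>2 * (q\<^sup>2 * x - 1) * (q * x - 1) * (x - y))
       + n4 * (q ^ 3 * y ^ 3 * (q ^ 3 * x - 1) * (q\<^sup>2 * x - 1) * (q * x - 1))
     = D * (q ^ 3 * x ^ 3 * (q ^ 3 * y - 1) * denom_factor G C (q ^ 3 * y) * (q\<^sup>2 * x - 1) * (q * x - 1))"
      (is ?gen)
    and "q\<^sup>2 * (n1 * (x - 1) + n2 * (q * x - 1) + n3 * (q\<^sup>2 * x - 1) + n4 * (q ^ 3 * x - 1))
     = D * (q ^ 8 * x ^ 3 * (q - 1) * denom_factor G C q)" (is ?one)
    and "q ^ 4 * (n1 * ((x - 1) * (x - q)) + n2 * ((q * x - 1) * (q * x - q))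
       + n3 * ((q\<^sup>2 * x - 1) * (q\<^sup>2 * x - q)) + n4 * ((q ^ 3 * x - 1) * (q ^ 3 * x - q)))
     = D * (q ^ 8 * x ^ 3 * (q\<^sup>2 - 1) * denom_factor G C (q\<^sup>2) * (q\<^sup>2 * x - 1))" (is ?two)
proof -
  show ?gen unfolding assms denom_factor_def by algebra
  show ?one unfolding assms denom_factor_def by algebra
  show ?two unfolding assms denom_factor_def by algebra
qed

text \<open>
  The relation for the coefficient of \<open>z\<^sup>i\<close>, once the ratio \<open>u\<^sub>i / u\<^sub>i\<^sub>-\<^sub>1\<close> has been inserted. As
  an identity in \<open>x\<close> it covers the values \<open>x = q\<^sup>-\<^sup>2\<close> and \<open>x = q\<^sup>-\<^sup>1\<close> that belong to \<open>n = 0, 1\<close> as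
  well. For \<open>i = 0\<close> it expresses that the four coefficients add up to zero.
\<close>

lemma newton_prod_combination:
  fixes q G C x :: real
  assumes q: "0 < q" "q < 1"
  defines "X \<equiv> q\<^sup>2 * x"
  shows "(q ^ i)\<^sup>2 * (nu1 q G C X * newton_prod q x i + nu2 q G C X * newton_prod q (q * x) i
            + nu3 q G C X * newton_prod q (q\<^sup>2 * x) i + nu4 q G C X * newton_prod q (q ^ 3 * x) i)
       = q ^ 8 * x ^ 3 * (q ^ i - 1) * denom_factor G C (q ^ i) * newton_prod q (q\<^sup>2 * x) (i - 1)"
    (is "?L = ?R")
proof -
  define D where "D = (1 - q)\<^sup>2 * (1 + q)"
  define n1 n2 n3 n4 where n: "n1 = D * nu1 q G C X" "n2 = D * nu2 q G C X"
    "n3 = D * nu3 q G C X" "n4 = D * nu4 q G C X"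
  have D: "D \<noteq> 0" using q by (simp add: D_def)
  have s: "q * X = q ^ 3 * x" "X / q = q * x"
    using q by (simp_all add: X_def power2_eq_square power3_eq_cube)
  have q': "1 - q \<noteq> 0" "1 + q \<noteq> 0" using q by auto
  have n1: "n1 = - n2 - n3 - n4"
    by (simp add: n nu1_def right_diff_distrib)
  have n4: "n4 = D * denom_factor G C (q ^ 3 * x)"
    by (simp add: n nu4_def s)
  note P = newton_prod_combination_cleared[OF refl refl refl n4 D_def
      nu_cleared[OF q', of G C X, folded D_def n, unfolded s, unfolded X_def] n1]
  have DL: "D * ?L = (q ^ i)\<^sup>2 * (n1 * newton_prod q x i + n2 * newton_prod q (q * x) i
            + n3 * newton_prod q (q\<^sup>2 * x) i + n4 * newton_prod q (q ^ 3 * x) i)"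
    by (simp add: n algebra_simps)
  have "i = i - 3 + 3" if "i \<noteq> 0" "i \<noteq> 1" "i \<noteq> 2"
    using that by presburger
  then consider "i = 0" | "i = 1" | "i = 2" | j where "i = j + 3"
    by blast
  then have "D * ?L = D * ?R"
  proof cases
    case 1
    then show ?thesis by (simp add: newton_prod_def nu1_def)
  next
    case 2
    then show ?thesis unfolding DL using P(2) by (simp add: newton_prod_def mult.assoc)
  next
    case 3
    have "newton_prod q t 2 = (t - 1) * (t - q)" "newton_prod q t 1 = t - 1" for t
      by (simp_all add: newton_prod_def numeral_2_eq_2)
    moreover have "(q\<^sup>2)\<^sup>2 = q ^ 4" by (simp flip: power_mult)
    ultimately show ?thesis unfolding DL unfolding 3 using P(3) by (simp add: mult.assoc)
  next
    case (4 j)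
    define y W where "y = q ^ j" and "W = newton_prod q x j"
    \<comment> \<open>Write each argument as an iterated rescaling, so that \<open>newton_prod_shift\<close> can reduce all
      five products to multiples of \<open>W\<close>.\<close>
    have s3: "q\<^sup>2 * x = q * (q * x)" "q ^ 3 * x = q * (q * (q * x))"
      by (simp_all add: power2_eq_square power3_eq_cube)
    have yq: "q ^ Suc j = q * y" "q ^ Suc (Suc j) = q\<^sup>2 * y" "q ^ i = q ^ 3 * y"
      by (simp_all add: y_def 4 power2_eq_square power3_eq_cube power_add)
    have i: "i = Suc (Suc (Suc j))" using 4 by auto
    have w: "newton_prod q x i = (x - y) * (x - q * y) * (x - q\<^sup>2 * y) * W"
      "newton_prod q (q * x) i = q\<^sup>2 * y * (q * x - 1) * ((x - y) * (x - q * y)) * W"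
      "newton_prod q (q\<^sup>2 * x) i = q ^ 3 * y\<^sup>2 * (q\<^sup>2 * x - 1) * (q * x - 1) * (x - y) * W"
      "newton_prod q (q ^ 3 * x) i = q ^ 3 * y ^ 3 * (q ^ 3 * x - 1) * (q\<^sup>2 * x - 1) * (q * x - 1) * W"
      "newton_prod q (q\<^sup>2 * x) (i - 1) = q * y\<^sup>2 * (q\<^sup>2 * x - 1) * (q * x - 1) * W"
      unfolding i diff_Suc_1 s3 newton_prod_shift
      by (simp_all add: newton_prod_Suc yq W_def[symmetric] y_def[symmetric]
          power2_eq_square power3_eq_cube)
    have "D * ?L = (q ^ 3 * y)\<^sup>2 * W *
       (n1 * ((x - y) * (x - q * y) * (x - q\<^sup>2 * y))
       + n2 * (q\<^sup>2 * y * (q * x - 1) * ((x - y) * (x - q * y)))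
       + n3 * (q ^ 3 * y\<^sup>2 * (q\<^sup>2 * x - 1) * (q * x - 1) * (x - y))
       + n4 * (q ^ 3 * y ^ 3 * (q ^ 3 * x - 1) * (q\<^sup>2 * x - 1) * (q * x - 1)))"
      unfolding DL unfolding w yq(3) distrib_left by (simp only: mult_ac)
    also have "\<dots> = D * ?R"
      unfolding P(1) w yq(3) by (simp add: power_mult_distrib flip: power_mult) (simp add: eval_nat_numeral)
    finally show ?thesis .
  qed
  then show ?thesis using D by simp
qed

section \<open>The recurrence for general X\<close>

definition laguerre_coeff :: "real \<Rightarrow> real \<Rightarrow> real \<Rightarrow> nat \<Rightarrow> real" where
  "laguerre_coeff q G C i = q ^ (i choose 2) * (G * q) ^ i / (qpoch (G * q) q i * qpoch (C * q) q i)"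

lemma laguerre_coeff_Suc:
  assumes "denom_factor G C (q ^ Suc i) \<noteq> 0"
  shows "laguerre_coeff q G C (Suc i) * denom_factor G C (q ^ Suc i) = G * q ^ Suc i * laguerre_coeff q G C i"
proof -
  have "Suc i choose 2 = i + (i choose 2)"
    by (simp add: numeral_2_eq_2)
  then show ?thesis using assms
    by (simp add: laguerre_coeff_def qpoch_def denom_factor_def power_add mult_ac)
qed

text \<open>
  The coefficient of \<open>z\<^sup>i\<^sup>+\<^sup>1\<close> in the recurrence: the left-hand side collects the terms without an
  explicit \<open>z\<close>, the right-hand side those multiplied by \<open>z\<close>, whose coefficient index is therefore
  one lower. Both are multiples of the same \<open>newton_prod q X i\<close>.
\<close>

lemma coefficient_recurrence:
  fixes q G C x :: real
  assumes q: "0 < q" "q < 1" and dnz: "denom_factor G C (q ^ Suc i) \<noteq> 0"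
  defines "X \<equiv> q\<^sup>2 * x"
  shows "q * laguerre_coeff q G C (Suc i)
           * (nu1 q G C X * newton_prod q x (Suc i) + nu2 q G C X * newton_prod q (q * x) (Suc i)
              + nu3 q G C X * newton_prod q (q\<^sup>2 * x) (Suc i) + nu4 q G C X * newton_prod q (q ^ 3 * x) (Suc i))
       = laguerre_coeff q G C i * (X\<^sup>2 * G * q\<^sup>2)
           * ((1 - X) * newton_prod q (q * x) i - (1 - q * X) * newton_prod q (q\<^sup>2 * x) i)"
    (is "q * ?u' * ?S = ?u * _ * ?T")
proof -
  define Y w where "Y = q ^ i" and "w = newton_prod q X i"
  have Y: "Y > 0" "q ^ Suc i = q * Y" using q by (auto simp: Y_def)
  have S: "(q * Y)\<^sup>2 * ?S = q ^ 8 * x ^ 3 * (q * Y - 1) * denom_factor G C (q * Y) * w"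
    using newton_prod_combination[OF q, of "Suc i" G C x, folded X_def]
    unfolding Y w_def diff_Suc_1 X_def[symmetric] .
  have T: "Y * ?T = X * (q * Y - 1) * w"
    using newton_prod_lowering[of q i x]
    unfolding w_def X_def[symmetric] Y_def[symmetric] by (simp add: algebra_simps)
  have u: "?u' * denom_factor G C (q * Y) = G * (q * Y) * ?u"
    using laguerre_coeff_Suc[OF dnz] unfolding Y .
  \<comment> \<open>Stated for variables in place of the composite terms, which keeps the polynomial
    arithmetic small.\<close>
  have cancel: "(q * Y)\<^sup>2 * (q * u' * S) = (q * Y)\<^sup>2 * (u * (X\<^sup>2 * G * q\<^sup>2) * T)"
    if "(q * Y)\<^sup>2 * S = q ^ 8 * x ^ 3 * (q * Y - 1) * a * w" "Y * T = X * (q * Y - 1) * w"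
      "u' * a = G * (q * Y) * u" for u' u S T a
  proof -
    have "(q * Y)\<^sup>2 * (q * u' * S) = q * u' * ((q * Y)\<^sup>2 * S)"
      by (simp only: mult_ac)
    also have "\<dots> = (u' * a) * (q ^ 9 * x ^ 3 * (q * Y - 1) * w)"
      unfolding that(1) by algebra
    also have "\<dots> = q\<^sup>2 * Y * (u * (X\<^sup>2 * G * q\<^sup>2)) * (Y * T)"
      unfolding that(2,3) X_def by algebra
    also have "\<dots> = (q * Y)\<^sup>2 * (u * (X\<^sup>2 * G * q\<^sup>2) * T)"
      by (simp add: power2_eq_square)
    finally show ?thesis .
  qed
  from cancel[OF S T u] show ?thesis using q Y by simp
qed

text \<open>
  At \<open>x = q\<^sup>k\<close> the terms with \<open>i > k\<close> vanish, but for general \<open>x\<close> the sum depends on the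
  truncation \<open>N\<close>, which is therefore a separate argument.
\<close>

definition laguerre_sum :: "real \<Rightarrow> real \<Rightarrow> real \<Rightarrow> nat \<Rightarrow> real \<Rightarrow> complex \<Rightarrow> complex" where
  "laguerre_sum q G C N x z = (\<Sum>i\<le>N. of_real (laguerre_coeff q G C i * newton_prod q x i) * z ^ i)"

lemma laguerre_sum_power:
  assumes "k \<le> N"
  shows "laguerre_sum q G C N (q ^ k) z = laguerre_sum q G C k (q ^ k) z"
  unfolding laguerre_sum_def using assms by (intro sum.mono_neutral_right) (auto simp: newton_prod_eq_0)

text \<open>
  The truncations differ by one because of the explicit factor \<open>z\<close> on the right; with them the two
  sides agree term by term for every \<open>x\<close>.
\<close>

lemma laguerre_sum_recurrence:
  fixes q G C x :: real
  assumes q: "0 < q" "q < 1" and dnz: "\<And>i. denom_factor G C (q ^ Suc i) \<noteq> 0"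
  defines "X \<equiv> q\<^sup>2 * x"
  shows "of_real q * (of_real (nu1 q G C X) * laguerre_sum q G C (Suc N) x z
           + of_real (nu2 q G C X) * laguerre_sum q G C (Suc N) (q * x) z
           + of_real (nu3 q G C X) * laguerre_sum q G C (Suc N) (q\<^sup>2 * x) z
           + of_real (nu4 q G C X) * laguerre_sum q G C (Suc N) (q ^ 3 * x) z)
       = z * of_real (X\<^sup>2 * G * q\<^sup>2)
           * (of_real (1 - X) * laguerre_sum q G C N (q * x) z
              - of_real (1 - q * X) * laguerre_sum q G C N (q\<^sup>2 * x) z)"
    (is "?L = ?R")
proof -
  define S where "S i = q * laguerre_coeff q G C i
       * (nu1 q G C X * newton_prod q x i + nu2 q G C X * newton_prod q (q * x) i
          + nu3 q G C X * newton_prod q (q\<^sup>2 * x) i + nu4 q G C X * newton_prod q (q ^ 3 * x) i)" for i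
  have "?L = (\<Sum>i\<le>Suc N. of_real (S i) * z ^ i)"
    unfolding laguerre_sum_def S_def sum_distrib_left sum.distrib[symmetric]
    by (rule sum.cong) (simp_all add: algebra_simps)
  also have "\<dots> = of_real (S 0) + (\<Sum>i\<le>N. of_real (S (Suc i)) * z ^ Suc i)"
    by (simp add: sum.atMost_Suc_shift del: sum.atMost_Suc)
  also have "S 0 = 0"
    by (simp add: S_def newton_prod_def nu1_def)
  also have "of_real 0 + (\<Sum>i\<le>N. of_real (S (Suc i)) * z ^ Suc i) = ?R"
    unfolding S_def X_def coefficient_recurrence[OF q dnz] unfolding laguerre_sum_def
      sum_distrib_left sum_subtractf[symmetric] add_0 of_real_0
    by (rule sum.cong) (simp_all add: algebra_simps)
  finally show ?thesis .
qed

section \<open>The q-Laguerre polynomials and their coefficients\<close>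

lemma qpoch_negative_power:
  assumes "q > 0"
  shows "qpoch (q powr (- real n)) q i * (q ^ n) ^ i = newton_prod q (q ^ n) i"
proof -
  have "q powr (- real n) * q ^ n = 1"
    using assms by (simp add: powr_minus powr_realpow)
  moreover have "(1 - p * s) * t = t - s" if "p * t = 1" for p s t :: real
    using that by algebra
  ultimately have "(1 - q powr (- real n) * q ^ j) * q ^ n = q ^ n - q ^ j" for j
    by blast
  then show ?thesis
    using prod.distrib[of "\<lambda>j. 1 - q powr (- real n) * q ^ j" "\<lambda>_. q ^ n" "{..<i}"]
    by (simp add: qpoch_def newton_prod_def)
qed

lemma qLaguerre_eq_laguerre_sum:
  assumes q: "0 < q" "q < 1"
  shows "qLaguerre \<gamma> c q n z = laguerre_sum q (q powr \<gamma>) (q powr c) n (q ^ n) z"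
proof -
  have p: "q powr (\<gamma> + 1) = q powr \<gamma> * q" "q powr (c + 1) = q powr c * q"
    "q powr (real n + \<gamma> + 1) = q ^ n * (q powr \<gamma> * q)"
    using q by (simp_all add: powr_add powr_realpow)
  show ?thesis
    unfolding qLaguerre_finite_sum[OF q] laguerre_sum_def atMost_atLeast0
  proof (rule sum.cong)
    fix i
    let ?P = "qpoch (q powr (- real n)) q i" let ?G = "q powr \<gamma> * q"
    let ?d = "qpoch ?G q i * qpoch (q powr c * q) q i"
    \<comment> \<open>The sign \<open>(-1)\<^sup>i\<close> of the series cancels against the sign of its argument.\<close>
    have "of_real (?P / ?d) * (-1) ^ i * of_real (q ^ (i * (i - 1) div 2))
             * (- of_real (q ^ n * ?G) * z) ^ i
        = of_real (q ^ (i choose 2) * ?G ^ i / ?d * (?P * (q ^ n) ^ i)) * (((-1) * (-1)) ^ i * z ^ i)"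
      unfolding choose_two of_real_mult of_real_divide of_real_power power_mult_distrib minus_mult_left
      by (subst power_minus) (simp add: power_mult_distrib mult_ac)
    also have "\<dots> = of_real (laguerre_coeff q (q powr \<gamma>) (q powr c) i * newton_prod q (q ^ n) i) * z ^ i"
      unfolding qpoch_negative_power[OF q(1)] laguerre_coeff_def by simp
    finally show "of_real (?P / (qpoch (q powr (\<gamma> + 1)) q i * qpoch (q powr (c + 1)) q i))
             * (-1) ^ i * of_real (q ^ (i * (i - 1) div 2))
             * (- of_real (q powr (real n + \<gamma> + 1)) * z) ^ i
        = of_real (laguerre_coeff q (q powr \<gamma>) (q powr c) i * newton_prod q (q ^ n) i) * z ^ i"
      unfolding p .
  qed simp
qed

text \<open>
  The cases \<open>n = 0\<close> and \<open>n = 1\<close>, that is \<open>X = 1\<close> and \<open>X = q\<close>. The value of \<open>nu2\<close> at \<open>q\<close>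
  has no contribution of \<open>denom_factor G C (X / q)\<close>: its two occurrences cancel
  there, because \<open>1 - q X = (1 - q)(1 + q)\<close>.
\<close>

lemma nu_at_first_indices:
  assumes q: "0 < q" "q < 1"
  shows "nu2 q G C 1 = 0" "nu1 q G C 1 = 0"
    "nu2 q G C q = q * denom_factor G C (q\<^sup>2) - q ^ 3 * denom_factor G C q" "nu1 q G C q = 0"
proof -
  define D where "D = (1 - q)\<^sup>2 * (1 + q)"
  have D: "D \<noteq> 0" using q by (simp add: D_def)
  have q': "1 - q \<noteq> 0" "1 + q \<noteq> 0" using q by auto
  note cl = nu_cleared[OF q', of G C, folded D_def]
  show "nu2 q G C 1 = 0" by (simp add: nu2_def)
  then show "nu1 q G C 1 = 0" using q
    by (simp add: nu1_def nu3_def nu4_def)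
  have "D * nu2 q G C q = D * (q * denom_factor G C (q\<^sup>2) - q ^ 3 * denom_factor G C q)"
    unfolding cl unfolding D_def power2_eq_square[symmetric] by algebra
  then show nu2: "nu2 q G C q = q * denom_factor G C (q\<^sup>2) - q ^ 3 * denom_factor G C q"
    using D by simp
  have "D * nu3 q G C q = D * (- (1 + q) * denom_factor G C (q\<^sup>2) + q ^ 3 * denom_factor G C q)"
    unfolding cl unfolding D_def power2_eq_square[symmetric] by algebra
  then have "nu3 q G C q = - (1 + q) * denom_factor G C (q\<^sup>2) + q ^ 3 * denom_factor G C q"
    using D by simp
  then show "nu1 q G C q = 0"
    unfolding nu1_def nu2 nu4_def by (simp add: power2_eq_square algebra_simps)
qed

text \<open>
  For \<open>n \<ge> 2\<close> this is a matter of rewriting powers of \<open>q\<close>. For \<open>n \<le> 1\<close> it says in addition that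
  the separately prescribed values continue the general formulas.
\<close>

lemma mu_eq_nu:
  fixes q \<gamma> c :: real and n :: nat
  assumes q: "0 < q" "q < 1"
  defines "X \<equiv> q ^ n" and "G \<equiv> q powr \<gamma>" and "C \<equiv> q powr c"
  defines "K \<equiv> X ^ 3 * q * G\<^sup>2"
  shows "mu1 \<gamma> c q n = K * nu1 q G C X"
    and "mu2 \<gamma> c q n = K * nu2 q G C X"
    and "mu3 \<gamma> c q n = K * nu3 q G C X"
    and "mu4 \<gamma> c q n = K * nu4 q G C X"
    and "mu5 \<gamma> q n = K * (X\<^sup>2 * G * q\<^sup>2) * (1 - X)"
    and "mu6 \<gamma> q n = - (K * (X\<^sup>2 * G * q\<^sup>2) * (1 - q * X))"
proof -
  have pX: "q powr real n = X" using q by (simp add: X_def powr_realpow)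
  have pow: "q powr (real k * t) = (q powr t) ^ k" for k t
    using q by (metis mult.commute powr_powr powr_realpow powr_gt_zero)
  have p2: "q powr (2 * \<gamma>) = G\<^sup>2" and p3: "q powr (3 * \<gamma>) = G ^ 3"
    using pow[of 2 \<gamma>] pow[of 3 \<gamma>] by (simp_all add: G_def)
  have pX3: "q powr (3 * real n) = X ^ 3" and pX5: "q powr (5 * real n) = X ^ 5"
    using pow[of 3 "real n"] pow[of 5 "real n"] by (simp_all add: pX)
  have e: "q powr (3 * real n + 2 * \<gamma> + 1) = K" "q powr (3 * real n + 2 * \<gamma> + 3) = K * q\<^sup>2"
    "q powr (3 * real n + 2 * \<gamma> + 5) = K * q ^ 4"
    "q powr (5 * real n + 3 * \<gamma> + 3) = K * (X\<^sup>2 * G * q\<^sup>2)"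
    "q powr (2 * \<gamma> + 5) = G\<^sup>2 * q ^ 5" "q powr (2 * \<gamma> + 7) = G\<^sup>2 * q ^ 7"
    "q powr (3 * \<gamma> + 8) = G ^ 3 * q ^ 8"
    using q by (simp_all add: powr_add p2 p3 pX3 pX5 K_def eval_nat_numeral)
  have g: "q powr (\<gamma> + n + 1) = G * (q * X)" "q powr (c + n + 1) = C * (q * X)"
    "q powr (\<gamma> + n) = G * X" "q powr (c + n) = C * X"
    "q powr (\<gamma> + n - 1) = G * (X / q)" "q powr (c + n - 1) = C * (X / q)"
    "q powr (\<gamma> + 2) = G * q\<^sup>2" "q powr (c + 2) = C * q\<^sup>2"
    "q powr (\<gamma> + 1) = G * q" "q powr (c + 1) = C * q"
    using q by (simp_all add: powr_add powr_diff pX G_def C_def)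
  have Xq: "q ^ (n + 1) = q * X" "q ^ n = X" by (simp_all add: X_def)
  have br: "qbracket2 (q * X) q = (1 - q * X) * (1 - X)" "qbracket2 (q\<^sup>2) q = (1 - q\<^sup>2) * (1 - q)"
    using q by (simp_all add: qbracket2_def power2_eq_square)
  show m3: "mu3 \<gamma> c q n = K * nu3 q G C X"
    unfolding mu3_def nu3_def denom_factor_def unfolding e g Xq
    by (simp only: mult_minus_left mult_minus_right mult_ac)
  show m4: "mu4 \<gamma> c q n = K * nu4 q G C X"
    unfolding mu4_def nu4_def e g denom_factor_def by simp
  show "mu6 \<gamma> q n = - (K * (X\<^sup>2 * G * q\<^sup>2) * (1 - q * X))"
    unfolding mu6_def e Xq by simp
  show "mu5 \<gamma> q n = K * (X\<^sup>2 * G * q\<^sup>2) * (1 - X)"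
  proof -
    consider "n = 0" | "n = 1" | "n \<ge> 2" by linarith
    then show ?thesis
    proof cases
      case 1
      then show ?thesis by (simp add: mu5_def X_def)
    next
      case 2
      then show ?thesis
        unfolding mu5_def e by (simp add: X_def K_def eval_nat_numeral)
    next
      case 3
      then show ?thesis unfolding mu5_def e Xq by simp
    qed
  qed
  show m2: "mu2 \<gamma> c q n = K * nu2 q G C X"
  proof -
    consider "n = 0" | "n = 1" | "n \<ge> 2" by linarith
    then show ?thesis
    proof cases
      case 1
      then show ?thesis using nu_at_first_indices[OF q] by (simp add: mu2_def X_def)
    next
      case 2
      then have "X = q" by (simp add: X_def)
      with 2 show ?thesis
        unfolding mu2_def e g K_def by (simp add: nu_at_first_indices[OF q] denom_factor_def algebra_simps eval_nat_numeral)
    next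
      case 3
      then have "\<not> n = 0" "\<not> n = 1" by auto
      have distrib: "K * (r + s - t - u - v + w) = K * r + K * s - K * t - K * u - K * v + K * w"
        for r s t u v w by (simp add: algebra_simps)
      from \<open>\<not> n = 0\<close> \<open>\<not> n = 1\<close> show ?thesis
        unfolding mu2_def nu2_def denom_factor_def unfolding e g Xq br distrib
        by (simp only: if_False times_divide_eq_right mult_ac)
    qed
  qed
  show "mu1 \<gamma> c q n = K * nu1 q G C X"
  proof (cases "n \<le> 1")
    case True
    then have "X = 1 \<or> X = q" by (cases n) (auto simp: X_def)
    then have "nu1 q G C X = 0" using nu_at_first_indices[OF q] by auto
    then show ?thesis using True by (simp add: mu1_def)
  next
    case False
    then show ?thesis by (simp add: mu1_def nu1_def m2 m3 m4 algebra_simps)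
  qed
qed

lemma denom_factor_nonzero:
  assumes "0 < q" "q < 1" "\<gamma> > -1" "c > -1"
  shows "denom_factor (q powr \<gamma>) (q powr c) (q ^ Suc i) \<noteq> 0"
proof -
  have "q powr t * q ^ Suc i \<noteq> 1" if "t > -1" for t
  proof -
    have "q powr t * q ^ Suc i = q powr (t + real (Suc i))"
      using assms by (simp only: powr_add powr_realpow)
    also have "\<dots> < 1"
      using assms that by (simp add: powr_def mult_pos_neg)
    finally show ?thesis by simp
  qed
  then show ?thesis using assms by (simp add: denom_factor_def)
qed

section \<open>The recurrence relation\<close>

theorem theorem2p2:
  fixes q \<gamma> c :: real and z :: complex and n :: nat
  assumes "0 < q" and "q < 1" and "\<gamma> > -1" and "c > 0"
  shows "of_real (q * mu1 \<gamma> c q n) * qLaguerre_seq \<gamma> c q (int n - 2) z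
       + (of_real (q * mu2 \<gamma> c q n) - z * of_real (mu5 \<gamma> q n)) * qLaguerre_seq \<gamma> c q (int n - 1) z
       + (of_real (q * mu3 \<gamma> c q n) - z * of_real (mu6 \<gamma> q n)) * qLaguerre_seq \<gamma> c q (int n) z
       + of_real (q * mu4 \<gamma> c q n) * qLaguerre_seq \<gamma> c q (int n + 1) z = 0"
proof -
  note q = assms(1,2)
  define X G C where X: "X = q ^ n" and G: "G = q powr \<gamma>" and C: "C = q powr c"
  define K where "K = X ^ 3 * q * G\<^sup>2"
  define x where "x = X / q\<^sup>2"
  define Y where "Y t N = laguerre_sum q G C N t z" for t N
  have seq: "qLaguerre_seq \<gamma> c q (int k) z = Y (q ^ k) N" if "k \<le> N" for k N
    unfolding Y_def laguerre_sum_power[OF that]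
    by (simp add: qLaguerre_seq_def qLaguerre_eq_laguerre_sum[OF q] G C)
  have args: "q\<^sup>2 * x = X" "q * x = X / q" "q ^ 3 * x = q * X"
    using q by (simp_all add: x_def power2_eq_square power3_eq_cube)
  note mu = mu_eq_nu(1-4)[OF q, of \<gamma> c n, folded X G C, folded K_def]
    mu_eq_nu(5,6)[OF q, of \<gamma> n, folded X G, folded K_def]
  have y1: "qLaguerre_seq \<gamma> c q (int n + 1) z = Y (q * X) (Suc n)"
    using seq[of "Suc n" "Suc n"] by (simp add: X add.commute)
  have y0: "qLaguerre_seq \<gamma> c q (int n) z = Y X N" if "n \<le> N" for N
    using seq[OF that] by (simp add: X)
  \<comment> \<open>Where the index is negative, the sequence is zero but the sum \<open>Y\<close> need not be; the two agree
    after multiplication with a coefficient that vanishes there.\<close>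
  have ym1: "w * qLaguerre_seq \<gamma> c q (int n - 1) z = w * Y (X / q) N"
    if "n \<le> N" "n = 0 \<Longrightarrow> w = 0" for w N
  proof (cases n)
    case (Suc k)
    then show ?thesis using seq[of k N] that q by (simp add: X)
  qed (use that in simp)
  have ym2: "of_real (mu1 \<gamma> c q n) * qLaguerre_seq \<gamma> c q (int n - 2) z
      = of_real (mu1 \<gamma> c q n) * Y x (Suc n)"
  proof (cases "n \<le> 1")
    case False
    then obtain k where k: "n = k + 2"
      using le_Suc_ex[of 2 n] by (auto simp: add.commute)
    then have "x = q ^ k" using q by (simp add: x_def X power_add power2_eq_square)
    then show ?thesis using seq[of k "Suc n"] k by simp
  qed (simp add: mu1_def)
  have dnz: "denom_factor G C (q ^ Suc i) \<noteq> 0" for i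
    unfolding G C using assms by (intro denom_factor_nonzero) auto
  have rec: "of_real q * (of_real (nu1 q G C X) * Y x (Suc n) + of_real (nu2 q G C X) * Y (X / q) (Suc n)
           + of_real (nu3 q G C X) * Y X (Suc n) + of_real (nu4 q G C X) * Y (q * X) (Suc n))
       = z * of_real (X\<^sup>2 * G * q\<^sup>2) * (of_real (1 - X) * Y (X / q) n - of_real (1 - q * X) * Y X n)"
    using laguerre_sum_recurrence[OF q dnz, of x n z] unfolding args Y_def .
  have ym1_mu2: "of_real (mu2 \<gamma> c q n) * qLaguerre_seq \<gamma> c q (int n - 1) z
      = of_real (mu2 \<gamma> c q n) * Y (X / q) (Suc n)"
    by (rule ym1) (simp_all add: mu2_def)
  have ym1_mu5: "of_real (mu5 \<gamma> q n) * qLaguerre_seq \<gamma> c q (int n - 1) z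
      = of_real (mu5 \<gamma> q n) * Y (X / q) n"
    by (rule ym1) (simp_all add: mu5_def)
  have collect: "of_real (q * m1) * s2 + (of_real (q * m2) - z * of_real m5) * s1
        + (of_real (q * m3) - z * of_real m6) * s0 + of_real (q * m4) * s
      = of_real q * (of_real m1 * s2 + of_real m2 * s1 + of_real m3 * s0 + of_real m4 * s)
        - z * (of_real m5 * s1 + of_real m6 * s0)" for m1 m2 m3 m4 m5 m6 and s2 s1 s0 s :: complex
    by (simp add: algebra_simps)
  have "of_real q * (of_real (mu1 \<gamma> c q n) * Y x (Suc n) + of_real (mu2 \<gamma> c q n) * Y (X / q) (Suc n)
        + of_real (mu3 \<gamma> c q n) * Y X (Suc n) + of_real (mu4 \<gamma> c q n) * Y (q * X) (Suc n))
      - z * (of_real (mu5 \<gamma> q n) * Y (X / q) n + of_real (mu6 \<gamma> q n) * Y X n)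
    = of_real K * (of_real q * (of_real (nu1 q G C X) * Y x (Suc n) + of_real (nu2 q G C X) * Y (X / q) (Suc n)
           + of_real (nu3 q G C X) * Y X (Suc n) + of_real (nu4 q G C X) * Y (q * X) (Suc n))
       - z * of_real (X\<^sup>2 * G * q\<^sup>2) * (of_real (1 - X) * Y (X / q) n - of_real (1 - q * X) * Y X n))"
    unfolding mu by (simp add: algebra_simps)
  also have "\<dots> = 0"
    unfolding rec by simp
  finally show ?thesis
    unfolding collect ym2 ym1_mu2 ym1_mu5 y1
    unfolding y0[of n, OF order_refl, symmetric] y0[of "Suc n", OF le_SucI[OF order_refl], symmetric] .
qed

end
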